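(* Let $S(n)$ denote the set of $n$-tuples $(x_1,\ldots,x_n)$ of positive integers with $x_1\leq\cdots\leq x_n$ and $\sigma_2(x_1,\ldots,x_n)=\sigma_n(x_1,\ldots,x_n)$, and write $\overline{1}_k$ for $k$ consecutive entries equal to $1$. Then \begin{align*} S(3)&=\{(2,3,6),(2,4,4),(3,3,3)\};\\ S(4)&=\{(1,2,4,14),(2,2,2,6)\};\\ S(5)&=\{(1,1,2,5,25),(1,1,2,7,11),(1,1,3,3,22),(1,1,3,4,9),(1,2,2,2,18),(1,2,2,4,4),(2,2,2,2,3)\};\\ S(6)&=\{(1,1,1,2,6,39),(1,1,1,2,7,22),(1,1,1,3,4,18),(1,1,1,3,6,8)\};\\ S(7)&=\{(\overline{1}_4,2,7,56),(\overline{1}_4,2,8,31),(\overline{1}_4,2,11,16),(\overline{1}_4,3,4,46),(\overline{1}_4,3,6,12),(\overline{1}_4,4,6,7),(\overline{1}_3,2,2,3,20)\};\\ S(8)&=\{(\overline{1}_5,2,8,76),(\overline{1}_5,2,10,30),(\overline{1}_5,4,4,22),(\overline{1}_4,2,2,3,50),(\overline{1}_3,2,2,2,3,5)\};\\ S(9)&=\{(\overline{1}_6,2,9,99),(\overline{1}_6,2,15,21),(\overline{1}_6,3,5,78),(\overline{1}_6,3,6,29),(\overline{1}_6,3,8,15)\};\\ S(10)&=\{(\overline{1}_7,2,10,125),(\overline{1}_7,2,11,67),(\overline{1}_7,2,13,38),(\overline{1}_7,3,6,51),(\overline{1}_7,3,7,28),(\overline{1}_7,4,4,93),\\ &\qquad(\overline{1}_7,4,5,26),(\overline{1}_7,6,7,7),(\overline{1}_6,2,3,3,21),(\overline{1}_6,3,3,3,8)\};\\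 S(11)&=\{(\overline{1}_8,2,11,154),(\overline{1}_8,2,12,82),(\overline{1}_8,2,13,58),(\overline{1}_8,2,14,46),(\overline{1}_8,2,16,34),(\overline{1}_8,2,18,28),\\ &\qquad(\overline{1}_8,2,19,26),(\overline{1}_8,2,22,22),(\overline{1}_8,3,6,118),(\overline{1}_8,3,7,43),(\overline{1}_8,3,8,28),(\overline{1}_8,3,10,18),\\ &\qquad(\overline{1}_8,3,13,13),(\overline{1}_8,4,5,40),(\overline{1}_8,4,6,22),(\overline{1}_8,4,7,16),(\overline{1}_8,4,8,13),(\overline{1}_8,4,10,10),\\ &\qquad(\overline{1}_8,5,5,19),(\overline{1}_8,6,6,10),(\overline{1}_8,7,7,7),(\overline{1}_7,2,2,4,97),(\overline{1}_7,2,2,5,27),(\overline{1}_7,2,2,6,17),\\ &\qquad(\overline{1}_7,2,2,7,13),(\overline{1}_6,2,2,2,3,11)\};\\ S(12)&=\{(\overline{1}_9,2,12,186),(\overline{1}_9,2,16,46),(\overline{1}_9,2,18,36),(\overline{1}_9,4,6,30),(\overline{1}_9,4,8,16),\\ &\qquad(\overline{1}_9,6,6,12),(\overline{1}_8,2,3,4,18),(\overline{1}_8,2,4,4,10),(\overline{1}_8,2,4,6,6),(\overline{1}_7,2,2,2,2,101)\};\\ S(13)&=\{(\overline{1}_{10},2,13,221),(\overline{1}_{10},2,23,31),(\overline{1}_{10},3,7,166),(\overline{1}_{10},3,12,21),(\overline{1}_{10},4,5,155),\\ &\qquad(\overline{1}_{10},5,5,34),(\overline{1}_9,2,3,3,129),(\overline{1}_9,3,3,3,16),(\overline{1}_8,2,2,4,4,4)\};\\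 S(14)&=\{(\overline{1}_{11},2,14,259),(\overline{1}_{11},2,15,136),(\overline{1}_{11},2,16,95),(\overline{1}_{11},2,19,54),(\overline{1}_{11},3,8,100),\\ &\qquad(\overline{1}_{11},3,10,38),(\overline{1}_{11},4,6,63),(\overline{1}_{11},4,7,34),(\overline{1}_{10},2,2,5,159),(\overline{1}_9,2,2,3,5,5)\};\\ S(15)&=\{(\overline{1}_{12},2,15,300),(\overline{1}_{12},2,16,157),(\overline{1}_{12},2,25,40),(\overline{1}_{12},2,27,36),(\overline{1}_{12},3,8,222),\\ &\qquad(\overline{1}_{12},3,9,79),(\overline{1}_{12},3,13,27),(\overline{1}_{12},3,14,24),(\overline{1}_{12},4,6,105),(\overline{1}_{12},4,13,14),\\ &\qquad(\overline{1}_{11},2,3,4,45),(\overline{1}_{11},2,3,7,12),(\overline{1}_{10},2,2,2,3,33)\};\\ S(16)&=\{(\overline{1}_{13},2,16,344),(\overline{1}_{13},2,22,62),(\overline{1}_{13},4,6,232),(\overline{1}_{13},4,8,38),(\overline{1}_{13},8,8,10),\\ &\qquad(\overline{1}_{12},2,2,6,107),(\overline{1}_{12},2,2,7,46),(\overline{1}_{12},2,3,6,18),(\overline{1}_{11},2,2,2,3,46)\}. \end{align*} In particular, $|S(n)|=3,2,7,4,7,5,5,10,26,10,9,10,13,9$ for $n=3,4,\ldots,16$ respectively. Moreover, $S(n)\neq\emptyset$ for every integer $n\geq 3$.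
   Context: $\sigma_k(x_1,\ldots,x_n)=\sum_{i_1<\cdots<i_k}x_{i_1}\cdots x_{i_k}$ is the $k$-th elementary symmetric polynomial. *)

theory Defs
  imports Main
begin

text \<open>
  An \<open>n\<close>-tuple is a list of length \<open>n\<close>. The index sequences \<open>i\<^sub>1 < \<dots> < i\<^sub>k\<close> in the
  elementary symmetric polynomial are the \<open>k\<close>-element sets of (zero-based) positions, so equal
  entries at different positions are counted separately.
\<close>

definition elem_sym :: "nat \<Rightarrow> 'a::comm_semiring_1 list \<Rightarrow> 'a" where
  "elem_sym k xs = (\<Sum>I | I \<subseteq> {..<length xs} \<and> card I = k. \<Prod>i\<in>I. xs ! i)"

definition S :: "nat \<Rightarrow> nat list set" where
  "S n = {xs. length xs = n \<and> (\<forall>x\<in>set xs. 0 < x) \<and> sorted xs \<and> elem_sym 2 xs = elem_sym n xs}"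

end

(*
  Lists of numbers at least c that extend a fixed prefix to a solution are enumerated depth first.
  The ratio of sigma_2 to sigma_n does not increase with any entry, so once continuing the
  prefix with copies of c already makes sigma_2 < sigma_n, no entries beyond c need to be tried; the
  last entry is the solution of a linear equation. For n from 3 to 16 this visits fewer than 400
  nodes. For every n, the tuple
  (1,...,1,2,n,z) is a solution with z = sigma_2(1,...,1,2,n), since the product 2n of the
  other entries exceeds their sum by one.
*)
theory Submission
  imports Defs "HOL-Library.Code_Binary_Nat"
begin

section \<open>Recursion for elementary symmetric polynomials\<close>

lemma elem_sym_0 [simp]: "elem_sym 0 xs = 1"
proof -
  have "{I. I \<subseteq> {..<length xs} \<and> card I = 0} = {{}}"
    by (auto dest: finite_subset)
  then show ?thesis by (simp add: elem_sym_def)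
qed

lemma elem_sym_Suc_Nil [simp]: "elem_sym (Suc k) [] = 0"
proof -
  have "{I. I \<subseteq> {..<length ([] :: 'a list)} \<and> card I = Suc k} = {}"
    by auto
  then show ?thesis unfolding elem_sym_def by (simp only: sum.empty)
qed

text \<open>Split the index sets by whether they contain position 0. The remaining positions,
  shifted down by one, index \<open>xs\<close>.\<close>

lemma elem_sym_Suc_Cons:
  "elem_sym (Suc k) (x # xs) = x * elem_sym k xs + elem_sym (Suc k) xs"
proof -
  define F where "F n j = {I. I \<subseteq> {..<n} \<and> card I = j}" for n j :: nat
  let ?l = "length xs" and ?ins = "\<lambda>J. insert 0 (Suc ` J)"
  have fin: "finite (F n j)" and finI: "I \<in> F n j \<Longrightarrow> finite I" for n j I
    by (auto simp: F_def dest: finite_subset)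
  have split: "F (Suc ?l) (Suc k) = ?ins ` F ?l k \<union> image Suc ` F ?l (Suc k)"
  proof (intro equalityI subsetI)
    fix I assume I: "I \<in> F (Suc ?l) (Suc k)"
    define J where "J = {i. Suc i \<in> I}"
    have SJ: "Suc ` J = I - {0}"
      by (auto simp: J_def image_iff) (metis not0_implies_Suc)
    have "card J = card (I - {0})"
      by (metis SJ card_image inj_Suc)
    moreover have "J \<subseteq> {..<?l}"
      using I by (auto simp: J_def F_def)
    ultimately show "I \<in> ?ins ` F ?l k \<union> image Suc ` F ?l (Suc k)"
    proof (cases "0 \<in> I")
      case True
      then have "I = ?ins J" using SJ by auto
      moreover have "J \<in> F ?l k"
        using True I finI[OF I] \<open>card J = _\<close> \<open>J \<subseteq> _\<close> by (simp add: F_def)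
      ultimately show ?thesis by blast
    next
      case False
      then have "I = Suc ` J" using SJ by auto
      moreover have "J \<in> F ?l (Suc k)"
        using False I \<open>card J = _\<close> \<open>J \<subseteq> _\<close> by (simp add: F_def)
      ultimately show ?thesis by blast
    qed
  qed (auto simp: F_def card_image card_insert_if finite_subset[OF _ finite_lessThan])
  \<comment> \<open>Position 0 is never a successor, so it cancels from both inserted sets;
    injectivity of \<open>Suc\<close> does the rest.\<close>
  have inj: "inj_on ?ins A" "inj_on (image Suc) A" for A
    by (auto simp: inj_on_def inj_image_eq_iff dest!: insert_ident[THEN iffD1, rotated 2])
  have "elem_sym (Suc k) (x # xs) = (\<Sum>I \<in> F (Suc ?l) (Suc k). \<Prod>i\<in>I. (x # xs) ! i)"
    by (simp add: elem_sym_def F_def)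
  also have "\<dots> = (\<Sum>I \<in> ?ins ` F ?l k. \<Prod>i\<in>I. (x # xs) ! i)
                + (\<Sum>I \<in> image Suc ` F ?l (Suc k). \<Prod>i\<in>I. (x # xs) ! i)"
    unfolding split by (rule sum.union_disjoint) (auto simp: fin)
  also have "(\<Sum>I \<in> ?ins ` F ?l k. \<Prod>i\<in>I. (x # xs) ! i) = (\<Sum>J \<in> F ?l k. x * (\<Prod>i\<in>J. xs ! i))"
    using finI by (simp add: sum.reindex[OF inj(1)] prod.reindex)
  also have "(\<Sum>I \<in> image Suc ` F ?l (Suc k). \<Prod>i\<in>I. (x # xs) ! i) = (\<Sum>J \<in> F ?l (Suc k). \<Prod>i\<in>J. xs ! i)"
    by (simp add: sum.reindex[OF inj(2)] prod.reindex)
  finally show ?thesis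
    by (simp add: elem_sym_def F_def sum_distrib_left)
qed

lemma elem_sym_1: "elem_sym (Suc 0) xs = sum_list xs"
  by (induction xs) (simp_all add: elem_sym_Suc_Cons)

lemma elem_sym_2_Nil [simp]: "elem_sym 2 [] = 0"
  by (simp add: numeral_2_eq_2)

lemma elem_sym_2_Cons [simp]: "elem_sym 2 (x # xs) = x * sum_list xs + elem_sym 2 xs"
  using elem_sym_Suc_Cons[of "Suc 0" x xs] by (simp add: elem_sym_1 numeral_2_eq_2)

lemma elem_sym_eq_0: "length xs < k \<Longrightarrow> elem_sym k xs = 0"
proof (induction xs arbitrary: k)
  case Nil
  then show ?case by (cases k) auto
next
  case (Cons x xs)
  then show ?case by (cases k) (auto simp: elem_sym_Suc_Cons)
qed

lemma elem_sym_length: "elem_sym (length xs) xs = prod_list xs"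
  by (induction xs) (simp_all add: elem_sym_Suc_Cons elem_sym_eq_0)

lemma elem_sym_2_append:
  "elem_sym 2 (xs @ ys) = elem_sym 2 xs + sum_list xs * sum_list ys + elem_sym 2 ys"
  by (induction xs) (simp_all add: algebra_simps)

text \<open>
  A prefix enters only through its sum \<open>s\<close>, its second elementary symmetric value \<open>a\<close> and its
  product \<open>p\<close>.
\<close>

definition completions :: "nat \<Rightarrow> nat \<Rightarrow> nat \<Rightarrow> nat \<Rightarrow> nat \<Rightarrow> nat list set" where
  "completions r c s a p = {ys. length ys = r \<and> (\<forall>y\<in>set ys. c \<le> y) \<and> sorted ys \<and>
     a + s * sum_list ys + elem_sym 2 ys = p * prod_list ys}"

text \<open>The empty prefix has sum 0, second symmetric value 0 and product 1; the lower bound 1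
  encodes positivity.\<close>

lemma S_eq_completions: "S n = completions n 1 0 0 1"
  by (auto simp: S_def completions_def elem_sym_length Suc_le_eq)

section \<open>Bounds that justify pruning\<close>

lemma prod_list_ge_power:
  fixes c :: nat
  shows "\<forall>y\<in>set ys. c \<le> y \<Longrightarrow> c ^ length ys \<le> prod_list ys"
  by (induction ys) (auto intro: mult_mono)

text \<open>For c > 0, sum divided by product is a sum of reciprocals of products of the other
  entries, hence largest when every entry is c. This is that bound with denominators
  cleared.\<close>

lemma sum_list_times_power_le:
  fixes c :: nat
  shows "\<forall>y\<in>set ys. c \<le> y \<Longrightarrow> sum_list ys * c ^ length ys \<le> length ys * c * prod_list ys"
proof (induction ys)
  case (Cons y ys)
  \<comment> \<open>The new entry y contributes this term. The old sum contributes the next one,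
    where a factor c is traded for y.\<close>
  have 1: "y * c * c ^ length ys \<le> y * c * prod_list ys"
    using prod_list_ge_power[of ys c] Cons.prems by simp
  have 2: "c * (sum_list ys * c ^ length ys) \<le> y * (length ys * c * prod_list ys)"
    using Cons by (intro mult_le_mono Cons.IH) simp_all
  show ?case using add_mono[OF 1 2] by (simp add: algebra_simps)
qed simp

text \<open>Same principle: each product of two entries, divided by the full product, is the
  reciprocal of the product of the remaining entries.\<close>

lemma elem_sym_2_times_power_le:
  fixes c :: nat
  shows "\<forall>y\<in>set ys. c \<le> y \<Longrightarrow>
    elem_sym 2 ys * c ^ length ys \<le> (length ys choose 2) * c\<^sup>2 * prod_list ys"
proof (induction ys)
  case (Cons y ys)
  have 1: "y * c * (sum_list ys * c ^ length ys) \<le> y * c * (length ys * c * prod_list ys)"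
    using sum_list_times_power_le[of ys c] Cons.prems by (intro mult_le_mono2) simp_all
  have 2: "c * (elem_sym 2 ys * c ^ length ys)
      \<le> y * ((length ys choose 2) * c\<^sup>2 * prod_list ys)"
    using Cons by (intro mult_le_mono Cons.IH) simp_all
  have "Suc (length ys) choose 2 = length ys + (length ys choose 2)"
    by (simp add: numeral_2_eq_2)
  then show ?case
    using add_mono[OF 1 2] by (simp add: power2_eq_square algebra_simps)
qed simp

text \<open>Divided by the product of the new entries, each of the three summands on the left of the
  equation is largest at r copies of c. If the left side falls short there, it falls short for every
  admissible list.\<close>

lemma completions_empty:
  assumes "a + s * (r * c) + (r choose 2) * c\<^sup>2 < p * c ^ r"
  shows "completions r c s a p = {}"
proof -
  have False if ys: "ys \<in> completions r c s a p" for ys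
  proof -
    from ys have r: "length ys = r" and ge: "\<forall>y\<in>set ys. c \<le> y"
      and eq: "a + s * sum_list ys + elem_sym 2 ys = p * prod_list ys"
      by (auto simp: completions_def)
    let ?P = "prod_list ys"
    have cP: "c ^ r \<le> ?P" using prod_list_ge_power[OF ge] r by simp
    \<comment> \<open>A zero power would make the right side of the strict hypothesis 0. Positivity
      of the product then keeps the final comparison strict.\<close>
    have "c ^ r > 0" using assms by (cases "c ^ r = 0") auto
    then have "?P > 0" using cP by linarith
    have "p * c ^ r * ?P = a * c ^ r + s * (sum_list ys * c ^ r) + elem_sym 2 ys * c ^ r"
      using eq by (metis (no_types, lifting) add_mult_distrib mult.assoc mult.commute)
    also have "\<dots> \<le> a * ?P + s * (r * c * ?P) + (r choose 2) * c\<^sup>2 * ?P"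
      using cP sum_list_times_power_le[OF ge] elem_sym_2_times_power_le[OF ge]
      unfolding r by (intro add_mono mult_le_mono2) simp_all
    also have "\<dots> = (a + s * (r * c) + (r choose 2) * c\<^sup>2) * ?P"
      by (simp add: algebra_simps)
    also have "\<dots> < p * c ^ r * ?P"
      using assms \<open>?P > 0\<close> by simp
    finally show False by simp
  qed
  then show ?thesis by blast
qed

section \<open>Base cases and branching of the search\<close>

lemma completions_0: "completions 0 c s a p = (if a = p then {[]} else {})"
  by (auto simp: completions_def)

text \<open>The last entry x satisfies (p - s) x = a. Positivity of a excludes p = s with a = 0,
  where every x would do; it holds once the prefix has two positive entries. The guard
  \<open>s < p\<close> keeps the truncated subtraction faithful.\<close>

lemma completions_1:
  assumes "a > 0"
  shows "completions (Suc 0) c s a p =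
    (if s < p \<and> (p - s) dvd a \<and> c \<le> a div (p - s) then {[a div (p - s)]} else {})"
proof -
  have *: "a + s * x = p * x \<longleftrightarrow> s < p \<and> a = (p - s) * x" for x
  proof (cases "s < p")
    case True
    then obtain d where "p = s + d" by (metis less_imp_add_positive)
    then show ?thesis using True by (auto simp: algebra_simps)
  next
    case False
    then have "p * x \<le> s * x" by simp
    then have "a + s * x \<noteq> p * x" using assms by linarith
    then show ?thesis using False by simp
  qed
  have "completions (Suc 0) c s a p = {[x] | x. c \<le> x \<and> a + s * x = p * x}"
    by (auto simp: completions_def length_Suc_conv)
  also have "\<dots> = {[x] | x. c \<le> x \<and> s < p \<and> a = (p - s) * x}"
    by (simp only: *)
  also have "\<dots> = (if s < p \<and> (p - s) dvd a \<and> c \<le> a div (p - s) then {[a div (p - s)]} else {})"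
    by (auto simp: dvd_def)
  finally show ?thesis .
qed

text \<open>With p = 1 the term y z cancels and leaves a + s (y + z) = 0, impossible for positive s,
  y and z.\<close>

lemma completions_2_one:
  assumes "c > 0" "s > 0"
  shows "completions 2 c s a (Suc 0) = {}"
proof -
  have False if ys: "ys \<in> completions 2 c s a (Suc 0)" for ys
  proof -
    obtain y z where yz: "ys = [y, z]"
      using ys by (auto simp: completions_def eval_nat_numeral length_Suc_conv)
    then show False
      using ys assms by (auto simp: completions_def)
  qed
  then show ?thesis by blast
qed

text \<open>Either the first entry is c and joins the prefix, or it is larger, and sortedness then
  puts every entry above c.\<close>

lemma completions_Suc:
  "completions (Suc r) c s a p =
     (#) c ` completions r c (s + c) (a + s * c) (p * c) \<union> completions (Suc r) (Suc c) s a p"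
proof -
  have "ys \<in> completions (Suc r) c s a p \<longleftrightarrow>
    ys \<in> (#) c ` completions r c (s + c) (a + s * c) (p * c) \<union> completions (Suc r) (Suc c) s a p"
    for ys
  proof (cases ys)
    case (Cons y zs)
    show ?thesis
    proof (cases "y = c")
      case True
      then show ?thesis
        unfolding Cons by (auto simp: completions_def image_iff algebra_simps)
    next
      case False
      then show ?thesis
        unfolding Cons by (fastforce simp: completions_def image_iff)
    qed
  qed (auto simp: completions_def)
  then show ?thesis by blast
qed

text \<open>
  The clause for \<open>p = 1\<close> is needed for termination: after a prefix of ones, two equal further
  entries never make \<open>\<sigma>\<^sub>n\<close> exceed \<open>\<sigma>\<^sub>2\<close>.
\<close>

partial_function (option) search :: "nat \<Rightarrow> nat \<Rightarrow> nat \<Rightarrow> nat \<Rightarrow> nat \<Rightarrow> nat list list option" where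
  "search r c s a p =
    (if r = 0 then Some (if a = p then [[]] else [])
     else if r = 1 \<and> 0 < a then
       Some (if s < p \<and> a mod (p - s) = 0 \<and> c \<le> a div (p - s) then [[a div (p - s)]] else [])
     else if r = 2 \<and> 0 < c \<and> 0 < s \<and> p = 1 then Some []
     else if a + s * (r * c) + (r * (r - 1) div 2) * (c * c) < p * c ^ r then Some []
     else Option.bind (search (r - 1) c (s + c) (a + s * c) (p * c)) (\<lambda>L.
          Option.bind (search r (c + 1) s a p) (\<lambda>M. Some (map ((#) c) L @ M))))"

text \<open>Fixpoint induction covers only calls that return a result, so no termination argument is
  needed here.\<close>

lemma search_sound: "search r c s a p = Some L \<Longrightarrow> completions r c s a p = set L"
proof (induction r c s a p L rule: search.raw_induct[rotated, consumes 1, case_names step])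
  \<comment> \<open>Here \<open>search\<close> is an arbitrary function, assumed sound in
    \<open>step(1)\<close>; \<open>step(2)\<close> says that the body built on it returns
    \<open>Some L\<close>.\<close>
  case (step search r c s a p L)
  show ?case
  proof (cases r)
    case 0
    then show ?thesis using step(2) by (auto simp: completions_0)
  next
    case (Suc q)
    consider "r = 1 \<and> 0 < a" | "r = 2 \<and> 0 < c \<and> 0 < s \<and> p = 1"
      | "\<not> (r = 1 \<and> 0 < a)" "\<not> (r = 2 \<and> 0 < c \<and> 0 < s \<and> p = 1)"
        "a + s * (r * c) + (r choose 2) * c\<^sup>2 < p * c ^ r"
      | "\<not> (r = 1 \<and> 0 < a)" "\<not> (r = 2 \<and> 0 < c \<and> 0 < s \<and> p = 1)"
        "\<not> a + s * (r * c) + (r choose 2) * c\<^sup>2 < p * c ^ r"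
      by blast
    then show ?thesis
    proof cases
      case 1
      then show ?thesis using step(2) by (auto simp: completions_1 dvd_eq_mod_eq_0)
    next
      case 2
      then show ?thesis using step(2) by (auto simp: completions_2_one)
    next
      case 3
      then show ?thesis using step(2) Suc completions_empty[OF 3(3)]
        by (auto simp: choose_two power2_eq_square)
    next
      case 4
      then obtain L1 L2 where L: "L = map ((#) c) L1 @ L2"
        and 1: "search (r - 1) c (s + c) (a + s * c) (p * c) = Some L1"
        and 2: "search r (c + 1) s a p = Some L2"
        using step(2) Suc by (auto simp: choose_two power2_eq_square bind_eq_Some_conv)
      then show ?thesis
        using step(1)[OF 1] step(1)[OF 2] Suc completions_Suc[of q c s a p] by simp
    qed
  qed
qed

section \<open>Evaluation for n from 3 to 16, and solutions for every n\<close>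

declare search.simps [code]

lemma S_eq_search:
  assumes "n \<in> set [3..<17]"
  shows "S n = set (the (search n 1 0 0 1))"
proof -
  \<comment> \<open>Termination is established by running the search, which makes the use of
    \<open>the\<close> legitimate.\<close>
  have "list_all (\<lambda>n. search n 1 0 0 1 \<noteq> None) [3..<17]"
    by code_simp
  then have "search n 1 0 0 1 \<noteq> None"
    using assms unfolding list_all_iff by (rule bspec)
  then show ?thesis
    by (auto simp: S_eq_completions search_sound)
qed

lemma S_nonempty:
  assumes "n \<ge> 3"
  shows "S n \<noteq> {}"
proof -
  define xs where "xs = replicate (n - 3) 1 @ [2, n]"
  define z where "z = elem_sym 2 xs"
  have sum: "sum_list xs = 2 * n - 1" and prod: "prod_list xs = 2 * n" and len: "length xs = n - 1"
    using assms by (simp_all add: xs_def sum_list_replicate)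
  \<comment> \<open>The pair 2, n alone contributes 2n to z, so z may stand last in the sorted
    list.\<close>
  have "n \<le> z"
    by (simp add: z_def xs_def elem_sym_2_append)
  then have "sorted (xs @ [z])" "\<forall>x\<in>set (xs @ [z]). 0 < x"
    using assms by (auto simp: xs_def sorted_append)
  moreover have "elem_sym 2 (xs @ [z]) = elem_sym n (xs @ [z])"
  proof -
    have "elem_sym 2 (xs @ [z]) = z + (2 * n - 1) * z"
      by (simp add: elem_sym_2_append z_def sum)
    also have "\<dots> = 2 * n * z"
      using assms by (cases n) auto
    also have "\<dots> = elem_sym n (xs @ [z])"
      using elem_sym_length[of "xs @ [z]"] assms by (simp add: len prod)
    finally show ?thesis .
  qed
  ultimately have "xs @ [z] \<in> S n"
    using assms len by (simp add: S_def)
  then show ?thesis by blast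
qed

theorem theorem2p14:
  shows
  "S 3 = {[2, 3, 6], [2, 4, 4], [3, 3, 3]} \<and>
   S 4 = {[1, 2, 4, 14], [2, 2, 2, 6]} \<and>
   S 5 = {[1, 1, 2, 5, 25], [1, 1, 2, 7, 11], [1, 1, 3, 3, 22], [1, 1, 3, 4, 9],
      [1, 2, 2, 2, 18], [1, 2, 2, 4, 4], [2, 2, 2, 2, 3]} \<and>
   S 6 = {[1, 1, 1, 2, 6, 39], [1, 1, 1, 2, 7, 22], [1, 1, 1, 3, 4, 18], [1, 1, 1, 3, 6, 8]} \<and>
   S 7 = {replicate 4 1 @ [2, 7, 56], replicate 4 1 @ [2, 8, 31], replicate 4 1 @ [2, 11, 16],
      replicate 4 1 @ [3, 4, 46], replicate 4 1 @ [3, 6, 12], replicate 4 1 @ [4, 6, 7],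
      replicate 3 1 @ [2, 2, 3, 20]} \<and>
   S 8 = {replicate 5 1 @ [2, 8, 76], replicate 5 1 @ [2, 10, 30], replicate 5 1 @ [4, 4, 22],
      replicate 4 1 @ [2, 2, 3, 50], replicate 3 1 @ [2, 2, 2, 3, 5]} \<and>
   S 9 = {replicate 6 1 @ [2, 9, 99], replicate 6 1 @ [2, 15, 21], replicate 6 1 @ [3, 5, 78],
      replicate 6 1 @ [3, 6, 29], replicate 6 1 @ [3, 8, 15]} \<and>
   S 10 = {replicate 7 1 @ [2, 10, 125], replicate 7 1 @ [2, 11, 67], replicate 7 1 @ [2, 13, 38],
      replicate 7 1 @ [3, 6, 51], replicate 7 1 @ [3, 7, 28], replicate 7 1 @ [4, 4, 93],
      replicate 7 1 @ [4, 5, 26], replicate 7 1 @ [6, 7, 7], replicate 6 1 @ [2, 3, 3, 21],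
      replicate 6 1 @ [3, 3, 3, 8]} \<and>
   S 11 = {replicate 8 1 @ [2, 11, 154], replicate 8 1 @ [2, 12, 82], replicate 8 1 @ [2, 13, 58],
      replicate 8 1 @ [2, 14, 46], replicate 8 1 @ [2, 16, 34], replicate 8 1 @ [2, 18, 28],
      replicate 8 1 @ [2, 19, 26], replicate 8 1 @ [2, 22, 22], replicate 8 1 @ [3, 6, 118],
      replicate 8 1 @ [3, 7, 43], replicate 8 1 @ [3, 8, 28], replicate 8 1 @ [3, 10, 18],
      replicate 8 1 @ [3, 13, 13], replicate 8 1 @ [4, 5, 40], replicate 8 1 @ [4, 6, 22],
      replicate 8 1 @ [4, 7, 16], replicate 8 1 @ [4, 8, 13], replicate 8 1 @ [4, 10, 10],
      replicate 8 1 @ [5, 5, 19], replicate 8 1 @ [6, 6, 10], replicate 8 1 @ [7, 7, 7],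
      replicate 7 1 @ [2, 2, 4, 97], replicate 7 1 @ [2, 2, 5, 27], replicate 7 1 @ [2, 2, 6, 17],
      replicate 7 1 @ [2, 2, 7, 13], replicate 6 1 @ [2, 2, 2, 3, 11]} \<and>
   S 12 = {replicate 9 1 @ [2, 12, 186], replicate 9 1 @ [2, 16, 46], replicate 9 1 @ [2, 18, 36],
      replicate 9 1 @ [4, 6, 30], replicate 9 1 @ [4, 8, 16], replicate 9 1 @ [6, 6, 12],
      replicate 8 1 @ [2, 3, 4, 18], replicate 8 1 @ [2, 4, 4, 10], replicate 8 1 @ [2, 4, 6, 6],
      replicate 7 1 @ [2, 2, 2, 2, 101]} \<and>
   S 13 = {replicate 10 1 @ [2, 13, 221], replicate 10 1 @ [2, 23, 31], replicate 10 1 @ [3, 7, 166],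
      replicate 10 1 @ [3, 12, 21], replicate 10 1 @ [4, 5, 155], replicate 10 1 @ [5, 5, 34],
      replicate 9 1 @ [2, 3, 3, 129], replicate 9 1 @ [3, 3, 3, 16], replicate 8 1 @ [2, 2, 4, 4, 4]} \<and>
   S 14 = {replicate 11 1 @ [2, 14, 259], replicate 11 1 @ [2, 15, 136], replicate 11 1 @ [2, 16, 95],
      replicate 11 1 @ [2, 19, 54], replicate 11 1 @ [3, 8, 100], replicate 11 1 @ [3, 10, 38],
      replicate 11 1 @ [4, 6, 63], replicate 11 1 @ [4, 7, 34], replicate 10 1 @ [2, 2, 5, 159],
      replicate 9 1 @ [2, 2, 3, 5, 5]} \<and>
   S 15 = {replicate 12 1 @ [2, 15, 300], replicate 12 1 @ [2, 16, 157], replicate 12 1 @ [2, 25, 40],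
      replicate 12 1 @ [2, 27, 36], replicate 12 1 @ [3, 8, 222], replicate 12 1 @ [3, 9, 79],
      replicate 12 1 @ [3, 13, 27], replicate 12 1 @ [3, 14, 24], replicate 12 1 @ [4, 6, 105],
      replicate 12 1 @ [4, 13, 14], replicate 11 1 @ [2, 3, 4, 45], replicate 11 1 @ [2, 3, 7, 12],
      replicate 10 1 @ [2, 2, 2, 3, 33]} \<and>
   S 16 = {replicate 13 1 @ [2, 16, 344], replicate 13 1 @ [2, 22, 62], replicate 13 1 @ [4, 6, 232],
      replicate 13 1 @ [4, 8, 38], replicate 13 1 @ [8, 8, 10], replicate 12 1 @ [2, 2, 6, 107],
      replicate 12 1 @ [2, 2, 7, 46], replicate 12 1 @ [2, 3, 6, 18], replicate 11 1 @ [2, 2, 2, 3, 46]} \<and>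
   map (\<lambda>n. card (S n)) [3..<17] = [3, 2, 7, 4, 7, 5, 5, 10, 26, 10, 9, 10, 13, 9] \<and>
   (\<forall>n\<ge>3. S n \<noteq> {})"
proof -
  \<comment> \<open>The cardinality is taken of the set, so a repetition in the search output could
    not distort the count.\<close>
  have "map (\<lambda>n. card (set (the (search n 1 0 0 1)))) [3..<17] =
      [3, 2, 7, 4, 7, 5, 5, 10, 26, 10, 9, 10, 13, 9]"
    by code_simp
  moreover have "map (\<lambda>n. card (S n)) [3..<17] =
      map (\<lambda>n. card (set (the (search n 1 0 0 1)))) [3..<17]"
    by (intro map_cong refl) (simp only: S_eq_search)
  ultimately have card: "map (\<lambda>n. card (S n)) [3..<17] =
      [3, 2, 7, 4, 7, 5, 5, 10, 26, 10, 9, 10, 13, 9]"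
    by (simp only:)
  have nonempty: "\<forall>n\<ge>3. S n \<noteq> {}"
    by (simp add: S_nonempty)
  show ?thesis
    \<comment> \<open>For each listed n, \<open>simp\<close> discharges the range condition and
      \<open>code_simp\<close> compares the search result with the stated tuples as sets, so their
      order is irrelevant.\<close>
    by (intro conjI; (fact card | fact nonempty | rule trans[OF S_eq_search], simp, code_simp))
qed

end
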